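(* Let $Q=(q_{ij})$ be a real symmetric $n\times n$ matrix with zero diagonal, $c\in\mathbb{R}^n$, $R_i=\{j:q_{ij}\neq0\}$, and let $\gamma_{ij}>0$ and $\delta_{ij}>0$ for $j\in R_i$, $i=1,\dots,n$. Consider the MILP GW($*,\gamma+\delta$) in variables $x_i$ and $y_{ij}$ ($j\in R_i$): maximize $\sum_{i=1}^n\sum_{j\in R_i}q_{ij}y_{ij}+\sum_{i=1}^n c_ix_i$ subject to $x_i+x_j-y_{ij}\le 1$ for all $j\in R_i$, $i=1,\dots,n$; $\sum_{j\in R_i}\gamma_{ij}y_{ij}+\sum_{j\in R_i}\delta_{ij}y_{ji}\le\left(\sum_{j\in R_i}\gamma_{ij}+\sum_{j\in R_i}\delta_{ij}\right)x_i$ for $i=1,\dots,n$; $x_i\in\{0,1\}$ for all $i$; $0\le y_{ij}\le 1$ for all $j\in R_i$, $i=1,\dots,n$. Then GW($*,\gamma+\delta$) is a valid formulation of QUBO.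
   Context: QUBO is the problem: maximize $\sum_{i=1}^n\sum_{j\in R_i}q_{ij}x_ix_j+\sum_{i=1}^n c_ix_i$ over $x\in\{0,1\}^n$. An MILP in variables $(x,y)$ with objective $\sum_i\sum_{j\in R_i}q_{ij}y_{ij}+\sum_i c_ix_i$ is a valid formulation of QUBO if its optimal objective value equals the optimal value of QUBO and the $x$-part of every optimal solution of the MILP is an optimal solution of QUBO. *)

theory Defs
  imports "HOL-Analysis.Analysis"
begin

definition R :: "real^'n^'n \<Rightarrow> 'n \<Rightarrow> 'n set" where
  "R Q i = {j. Q $ i $ j \<noteq> 0}"

definition arcs :: "real^'n^'n \<Rightarrow> ('n \<times> 'n) set" where
  "arcs Q = (SIGMA i:UNIV. R Q i)"

definition binary_points :: "(real^'n) set" where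
  "binary_points = {x. \<forall>i. x $ i \<in> {0, 1}}"

definition qubo_objective :: "real^'n^'n \<Rightarrow> real^'n \<Rightarrow> real^'n \<Rightarrow> real" where
  "qubo_objective Q c x =
     (\<Sum>i\<in>UNIV. \<Sum>j\<in>R Q i. Q $ i $ j * x $ i * x $ j) + (\<Sum>i\<in>UNIV. c $ i * x $ i)"

definition milp_objective ::
    "real^'n^'n \<Rightarrow> real^'n \<Rightarrow> (real^'n) \<times> ('n \<times> 'n \<Rightarrow> real) \<Rightarrow> real" where
  "milp_objective Q c = (\<lambda>(x, y).
     (\<Sum>i\<in>UNIV. \<Sum>j\<in>R Q i. Q $ i $ j * y (i, j)) + (\<Sum>i\<in>UNIV. c $ i * x $ i))"

text \<open>A maximization problem is an objective \<open>f\<close> together with a feasible set \<open>S\<close>.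
  It has an optimal value only if the maximum is attained.\<close>

definition optimal_solution :: "('a \<Rightarrow> real) \<Rightarrow> 'a set \<Rightarrow> 'a \<Rightarrow> bool" where
  "optimal_solution f S s \<longleftrightarrow> is_arg_max f (\<lambda>z. z \<in> S) s"

definition optimal_value :: "('a \<Rightarrow> real) \<Rightarrow> 'a set \<Rightarrow> real \<Rightarrow> bool" where
  "optimal_value f S v \<longleftrightarrow> (\<exists>s. optimal_solution f S s \<and> f s = v)"

definition valid_formulation ::
    "real^'n^'n \<Rightarrow> real^'n \<Rightarrow> ((real^'n) \<times> ('n \<times> 'n \<Rightarrow> real)) set \<Rightarrow> bool" where
  "valid_formulation Q c F \<longleftrightarrow>
     (\<exists>v. optimal_value (milp_objective Q c) F v \<and>
          optimal_value (qubo_objective Q c) binary_points v) \<and>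
     (\<forall>x y. optimal_solution (milp_objective Q c) F (x, y) \<longrightarrow>
            optimal_solution (qubo_objective Q c) binary_points x)"

text \<open>There is a variable \<open>y (i, j)\<close> only for \<open>j \<in> R Q i\<close>. Extensionality fixes the irrelevant
  values of \<open>y\<close> elsewhere, so that \<open>y\<close> ranges over a copy of the real vectors indexed by the arcs.
  The term \<open>y (j, i)\<close> below is such a variable whenever \<open>Q\<close> is symmetric.\<close>

definition GW_feasible ::
    "real^'n^'n \<Rightarrow> real^'n^'n \<Rightarrow> real^'n^'n \<Rightarrow> ((real^'n) \<times> ('n \<times> 'n \<Rightarrow> real)) set" where
  "GW_feasible Q \<gamma> \<delta> = {(x, y).
     y \<in> extensional (arcs Q) \<and>
     (\<forall>i. \<forall>j\<in>R Q i. x $ i + x $ j - y (i, j) \<le> 1) \<and>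
     (\<forall>i. (\<Sum>j\<in>R Q i. \<gamma> $ i $ j * y (i, j)) + (\<Sum>j\<in>R Q i. \<delta> $ i $ j * y (j, i))
          \<le> ((\<Sum>j\<in>R Q i. \<gamma> $ i $ j) + (\<Sum>j\<in>R Q i. \<delta> $ i $ j)) * x $ i) \<and>
     (\<forall>i. x $ i \<in> {0, 1}) \<and>
     (\<forall>i. \<forall>j\<in>R Q i. 0 \<le> y (i, j) \<and> y (i, j) \<le> 1)}"

end

theory Submission
  imports Defs
begin

text \<open>If \<open>x\<^sub>i = 0\<close>, the aggregated constraint of \<open>i\<close> bounds a positive combination of
  nonnegative terms by \<open>0\<close>, so every \<open>y\<^sub>i\<^sub>j\<close> and every \<open>y\<^sub>j\<^sub>i\<close> vanishes. If \<open>x\<^sub>i = x\<^sub>j = 1\<close>, the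
  constraint \<open>x\<^sub>i + x\<^sub>j - y\<^sub>i\<^sub>j \<le> 1\<close> forces \<open>y\<^sub>i\<^sub>j = 1\<close>. Hence the feasible points are exactly the
  liftings of binary points by \<open>y\<^sub>i\<^sub>j = x\<^sub>i x\<^sub>j\<close>, on which both objectives agree.\<close>

definition lift_point :: "real^'n^'n \<Rightarrow> real^'n \<Rightarrow> (real^'n) \<times> ('n \<times> 'n \<Rightarrow> real)" where
  "lift_point Q x = (x, restrict (\<lambda>(i, j). x $ i * x $ j) (arcs Q))"

lemma mem_arcs [simp]: "(i, j) \<in> arcs Q \<longleftrightarrow> j \<in> R Q i"
  by (simp add: arcs_def)

text \<open>Ensures that \<open>y (j, i)\<close> is a genuine variable whenever
  \<open>y (i, j)\<close> is one, so that its bounds hold and a restriction to \<open>arcs Q\<close>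
  keeps its value.\<close>

lemma R_sym:
  assumes "transpose Q = Q" "j \<in> R Q i"
  shows "i \<in> R Q j"
  using assms by (metis (mono_tags) R_def mem_Collect_eq transpose_def vec_lambda_beta)

text \<open>Binary points are images of Boolean vectors, which form a finite type. Finiteness is
  what makes the QUBO maximum attained.\<close>

lemma finite_binary_points: "finite (binary_points :: (real^'n) set)"
proof (rule finite_subset)
  show "binary_points \<subseteq> range (\<lambda>b :: bool^'n. (\<chi> i. of_bool (b $ i)) :: real^'n)"
  proof
    fix x :: "real^'n"
    assume "x \<in> binary_points"
    then have "x = (\<chi> i. of_bool ((\<chi> i. x $ i = 1) $ i))"
      by (auto simp: binary_points_def vec_eq_iff)
    then show "x \<in> range (\<lambda>b :: bool^'n. \<chi> i. of_bool (b $ i))"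
      by blast
  qed
qed simp

lemma milp_objective_lift_point [simp]:
  "milp_objective Q c (lift_point Q x) = qubo_objective Q c x"
  by (simp add: milp_objective_def lift_point_def qubo_objective_def mult.assoc)

text \<open>The aggregated constraint holds term by term: multiply
  \<open>x $ i * x $ j \<le> x $ i\<close> by each positive weight and sum.\<close>

lemma lift_point_feasible:
  fixes Q \<gamma> \<delta> :: "real^'n^'n"
  assumes sym: "transpose Q = Q"
    and \<gamma>: "\<And>i j. j \<in> R Q i \<Longrightarrow> \<gamma> $ i $ j > 0"
    and \<delta>: "\<And>i j. j \<in> R Q i \<Longrightarrow> \<delta> $ i $ j > 0"
    and x: "x \<in> binary_points"
  shows "lift_point Q x \<in> GW_feasible Q \<gamma> \<delta>"
proof -
  have bin: "x $ i = 0 \<or> x $ i = 1" for i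
    using x by (auto simp: binary_points_def)
  have prod_le: "x $ i * x $ j \<le> x $ i" "x $ i * x $ j \<le> 1"
    and nonneg: "0 \<le> x $ i * x $ j"
    and cover: "x $ i + x $ j - x $ i * x $ j \<le> 1" for i j
    using bin[of i] bin[of j] by auto
  have "(\<Sum>j\<in>R Q i. \<gamma> $ i $ j * (x $ i * x $ j)) + (\<Sum>j\<in>R Q i. \<delta> $ i $ j * (x $ j * x $ i))
      \<le> ((\<Sum>j\<in>R Q i. \<gamma> $ i $ j) + (\<Sum>j\<in>R Q i. \<delta> $ i $ j)) * x $ i" for i
    unfolding distrib_right sum_distrib_right
    using prod_le(1)[of i] \<gamma> \<delta>
    by (intro add_mono sum_mono mult_left_mono) (auto simp: mult.commute less_imp_le)
  then show ?thesis
    using bin prod_le(2) nonneg cover R_sym[OF sym]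
    by (simp add: GW_feasible_def lift_point_def)
qed

lemma GW_feasible_eq_0:
  fixes Q \<gamma> \<delta> :: "real^'n^'n"
  assumes sym: "transpose Q = Q"
    and \<gamma>: "\<And>i j. j \<in> R Q i \<Longrightarrow> \<gamma> $ i $ j > 0"
    and \<delta>: "\<And>i j. j \<in> R Q i \<Longrightarrow> \<delta> $ i $ j > 0"
    and feas: "(x, y) \<in> GW_feasible Q \<gamma> \<delta>"
    and "x $ i = 0" and j: "j \<in> R Q i"
  shows "y (i, j) = 0" "y (j, i) = 0"
proof -
  \<comment> \<open>The bound on \<open>y (k, i)\<close> belongs to row \<open>k\<close>; symmetry
    of \<open>Q\<close> makes it available.\<close>
  have nonneg: "0 \<le> y (i, k)" "0 \<le> y (k, i)" if "k \<in> R Q i" for k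
    using feas that R_sym[OF sym that] by (auto simp: GW_feasible_def)
  have \<gamma>y: "0 \<le> \<gamma> $ i $ k * y (i, k)" and \<delta>y: "0 \<le> \<delta> $ i $ k * y (k, i)" if "k \<in> R Q i" for k
    using \<gamma> \<delta> nonneg that by (simp_all add: less_imp_le)
  have "(\<Sum>k\<in>R Q i. \<gamma> $ i $ k * y (i, k)) + (\<Sum>k\<in>R Q i. \<delta> $ i $ k * y (k, i))
      \<le> ((\<Sum>k\<in>R Q i. \<gamma> $ i $ k) + (\<Sum>k\<in>R Q i. \<delta> $ i $ k)) * x $ i"
    using feas by (simp add: GW_feasible_def)
  with \<open>x $ i = 0\<close>
  have "(\<Sum>k\<in>R Q i. \<gamma> $ i $ k * y (i, k)) + (\<Sum>k\<in>R Q i. \<delta> $ i $ k * y (k, i)) \<le> 0"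
    by simp
  moreover have "0 \<le> (\<Sum>k\<in>R Q i. \<gamma> $ i $ k * y (i, k))" "0 \<le> (\<Sum>k\<in>R Q i. \<delta> $ i $ k * y (k, i))"
    using \<gamma>y \<delta>y by (simp_all add: sum_nonneg)
  ultimately have "(\<Sum>k\<in>R Q i. \<gamma> $ i $ k * y (i, k)) = 0" "(\<Sum>k\<in>R Q i. \<delta> $ i $ k * y (k, i)) = 0"
    by linarith+
  then have "\<gamma> $ i $ j * y (i, j) = 0" "\<delta> $ i $ j * y (j, i) = 0"
    using \<gamma>y \<delta>y j by (simp_all add: sum_nonneg_eq_0_iff)
  then show "y (i, j) = 0" "y (j, i) = 0"
    using \<gamma>[OF j] \<delta>[OF j] by auto
qed

lemma GW_feasible_eq_lift_point:
  fixes Q \<gamma> \<delta> :: "real^'n^'n"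
  assumes sym: "transpose Q = Q"
    and \<gamma>: "\<And>i j. j \<in> R Q i \<Longrightarrow> \<gamma> $ i $ j > 0"
    and \<delta>: "\<And>i j. j \<in> R Q i \<Longrightarrow> \<delta> $ i $ j > 0"
  shows "GW_feasible Q \<gamma> \<delta> = lift_point Q ` binary_points"
proof
  show "lift_point Q ` binary_points \<subseteq> GW_feasible Q \<gamma> \<delta>"
    using lift_point_feasible[OF sym \<gamma> \<delta>] by blast
  show "GW_feasible Q \<gamma> \<delta> \<subseteq> lift_point Q ` binary_points"
  proof clarify
    fix x :: "real^'n" and y :: "'n \<times> 'n \<Rightarrow> real"
    assume feas: "(x, y) \<in> GW_feasible Q \<gamma> \<delta>"
    then have ext: "y \<in> extensional (arcs Q)" and x: "x \<in> binary_points"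
      by (auto simp: GW_feasible_def binary_points_def)
    have "y (i, j) = x $ i * x $ j" if j: "j \<in> R Q i" for i j
    proof -
      note zero = GW_feasible_eq_0[OF sym \<gamma> \<delta> feas]
      have "x $ i = 0 \<or> x $ i = 1" "x $ j = 0 \<or> x $ j = 1"
        using x by (auto simp: binary_points_def)
      then consider "x $ i = 0" | "x $ j = 0" | "x $ i = 1" "x $ j = 1"
        by blast
      then show ?thesis
      proof cases
        case 1
        then show ?thesis using zero(1) j by simp
      next
        \<comment> \<open>Row \<open>j\<close> is used here: \<open>y (i, j)\<close> is its reverse
          variable, which the \<delta>-weighted sum controls.\<close>
        case 2
        then show ?thesis using zero(2) R_sym[OF sym j] by simp
      next
        case 3
        have "x $ i + x $ j - y (i, j) \<le> 1" "y (i, j) \<le> 1"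
          using feas j by (auto simp: GW_feasible_def)
        with 3 show ?thesis by simp
      qed
    qed
    \<comment> \<open>Off the arcs both functions take the default value \<open>undefined\<close>,
      so agreement on the arcs gives equality.\<close>
    then have "y = restrict (\<lambda>(i, j). x $ i * x $ j) (arcs Q)"
      using ext by (intro extensionalityI[where A = "arcs Q"]) auto
    with x show "(x, y) \<in> lift_point Q ` binary_points"
      by (auto simp: lift_point_def)
  qed
qed

text \<open>\<open>lift_point Q\<close> is injective, as its first component is \<open>x\<close>,
  and it carries one objective to the other; hence maximizers correspond over any
  \<open>S\<close>.\<close>

lemma optimal_solution_lift_point:
  "optimal_solution (milp_objective Q c) (lift_point Q ` S) (lift_point Q x)
    \<longleftrightarrow> optimal_solution (qubo_objective Q c) S x"
proof -
  have "lift_point Q x \<in> lift_point Q ` S \<longleftrightarrow> x \<in> S"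
    by (auto simp: lift_point_def)
  then show ?thesis
    by (auto simp: optimal_solution_def is_arg_max_def)
qed

theorem theorem9:
  fixes Q \<gamma> \<delta> :: "real^'n^'n" and c :: "real^'n"
  assumes "transpose Q = Q"
    and "\<And>i. Q $ i $ i = 0"
    and "\<And>i j. j \<in> R Q i \<Longrightarrow> \<gamma> $ i $ j > 0"
    and "\<And>i j. j \<in> R Q i \<Longrightarrow> \<delta> $ i $ j > 0"
  shows "valid_formulation Q c (GW_feasible Q \<gamma> \<delta>)"
proof -
  note F = GW_feasible_eq_lift_point[OF assms(1,3,4)]
  have "(0 :: real^'n) \<in> binary_points"
    by (simp add: binary_points_def)
  then obtain s where "is_arg_max (qubo_objective Q c) (\<lambda>z. z \<in> binary_points) s"
    \<comment> \<open>A maximizer is a minimizer of the negated objective, which exists on a finite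
      nonempty set.\<close>
    using ex_is_arg_min_if_finite[OF finite_binary_points, of "\<lambda>x. - qubo_objective Q c x"]
    by (auto simp: is_arg_min_def is_arg_max_def)
  then have s: "optimal_solution (qubo_objective Q c) binary_points s"
    by (simp add: optimal_solution_def)
  then have "optimal_solution (milp_objective Q c) (GW_feasible Q \<gamma> \<delta>) (lift_point Q s)"
    by (simp add: F optimal_solution_lift_point)
  with s have "\<exists>v. optimal_value (milp_objective Q c) (GW_feasible Q \<gamma> \<delta>) v \<and>
      optimal_value (qubo_objective Q c) binary_points v"
    unfolding optimal_value_def using milp_objective_lift_point by blast
  moreover have "optimal_solution (qubo_objective Q c) binary_points x"
    if opt: "optimal_solution (milp_objective Q c) (GW_feasible Q \<gamma> \<delta>) (x, y)" for x y
  proof -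
    \<comment> \<open>Optimality includes feasibility, so the pair is the lift of its own
      \<open>x\<close>-part and optimality passes to \<open>x\<close>.\<close>
    have "(x, y) \<in> lift_point Q ` binary_points"
      using opt by (simp add: optimal_solution_def is_arg_max_def F)
    then have "(x, y) = lift_point Q x"
      by (auto simp: lift_point_def)
    with opt show ?thesis
      by (simp add: F optimal_solution_lift_point)
  qed
  ultimately show ?thesis
    by (simp add: valid_formulation_def)
qed

end
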